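(* There is an absolute constant $C$ such that the following holds. Let $P\in\mathbb{R}^{n\times K}$ be nonzero, $\sigma^2=\|P\|_F^2$, $a_1,\dots,a_m\in\mathbb{R}^n$, $b_1,\dots,b_m\in\mathbb{R}$, $\mathcal{U}=\{u\in\mathbb{R}^K:\|u\|_2\le1\}$, and consider the robust linear program $$\exists?\ x\in\mathcal{D}:\quad (a_i+Pu_i)^\top x-b_i\le0\quad\forall u_i\in\mathcal{U},\ i=1,\dots,m,$$ with domain $\mathcal{D}=\{x\in\mathbb{R}^n:\|x\|_2\le1\}$. For every $\epsilon>0$, the Dual-Subgradient algorithm (described in the context), run with target accuracy $\epsilon/2$ and parameters $D=2$, $G=\sigma$, returns an $\epsilon$-approximate robust solution to this program (or correctly declares it infeasible) after at most $T\le 1+C\sigma^2/\epsilon^2$, i.e. $T=O(\sigma^2/\epsilon^2)$, calls to the LP oracle.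
   Context: Write $f_i(x,u)=(a_i+Pu)^\top x-b_i$. A point $x\in\mathcal{D}$ is an $\epsilon$-approximate robust solution if $f_i(x,u)\le\epsilon$ for all $u\in\mathcal{U}$ and all $i$. LP oracle $\mathcal{O}_\alpha$: takes $(u_1,\dots,u_m)\in\mathcal{U}^m$ and either outputs some $x\in\mathcal{D}$ with $f_i(x,u_i)\le\alpha$ for all $i$, or outputs "infeasible"; it may output "infeasible" only if no $x\in\mathcal{D}$ satisfies $f_i(x,u_i)\le0$ for all $i$. Dual-Subgradient algorithm with target accuracy $\alpha>0$ and parameters $D,G$: set $T=\lceil G^2D^2/\alpha^2\rceil$ and $\eta=D/(G\sqrt T)$. Choose $(u_1^1,\dots,u_m^1)\in\mathcal{U}^m$ arbitrarily. For $t=1,\dots,T$: if $t\ge2$, set $u_i^t=\dfrac{u_i^{t-1}+\eta P^\top x^{t-1}}{\max\{\|u_i^{t-1}+\eta P^\top x^{t-1}\|_2,1\}}$ for each $i$ (the Euclidean projection onto $\mathcal{U}$ of a gradient step in $u$); call $\mathcal{O}_\alpha(u_1^t,\dots,u_m^t)$; if it outputs "infeasible", stop and return "infeasible"; otherwise let $x^t$ be its output. After $T$ rounds return $\bar x=\frac1T\sum_{t=1}^Tx^t$. *)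

theory Defs
  imports "HOL-Analysis.L2_Norm" "HOL-Library.FuncSet" "Jordan_Normal_Form.Matrix"
begin

(* Vectors and matrices carry their dimensions as numbers rather than as types, so that one
   constant can be quantified before all the dimensions. *)

definition euclidean_norm :: "real vec \<Rightarrow> real" where
  "euclidean_norm v = L2_set (\<lambda>j. v $ j) {..<dim_vec v}"

definition frobenius_norm :: "real mat \<Rightarrow> real" where
  "frobenius_norm P = L2_set (\<lambda>(i, j). P $$ (i, j)) ({..<dim_row P} \<times> {..<dim_col P})"

definition unit_ball :: "nat \<Rightarrow> real vec set" where
  "unit_ball n = {v \<in> carrier_vec n. euclidean_norm v \<le> 1}"

definition constraint ::
  "real mat \<Rightarrow> (nat \<Rightarrow> real vec) \<Rightarrow> (nat \<Rightarrow> real) \<Rightarrow> nat \<Rightarrow> real vec \<Rightarrow> real vec \<Rightarrow> real" where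
  "constraint P a b i x u = (a i + P *\<^sub>v u) \<bullet> x - b i"

(* For an n x K matrix P the domain of x is the unit ball of R^n and the uncertainty set is
   the unit ball of R^K. *)

definition robust_solution ::
  "real mat \<Rightarrow> nat \<Rightarrow> (nat \<Rightarrow> real vec) \<Rightarrow> (nat \<Rightarrow> real) \<Rightarrow> real vec \<Rightarrow> bool" where
  "robust_solution P m a b x \<longleftrightarrow>
     x \<in> unit_ball (dim_row P) \<and>
     (\<forall>i\<in>{1..m}. \<forall>u\<in>unit_ball (dim_col P). constraint P a b i x u \<le> 0)"

definition approx_robust_solution ::
  "real mat \<Rightarrow> nat \<Rightarrow> (nat \<Rightarrow> real vec) \<Rightarrow> (nat \<Rightarrow> real) \<Rightarrow> real \<Rightarrow> real vec \<Rightarrow> bool" where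
  "approx_robust_solution P m a b \<epsilon> x \<longleftrightarrow>
     x \<in> unit_ball (dim_row P) \<and>
     (\<forall>i\<in>{1..m}. \<forall>u\<in>unit_ball (dim_col P). constraint P a b i x u \<le> \<epsilon>)"

(* An answer None stands for "infeasible". The first argument is the number of the call, so the
   oracle may answer the same query differently in different calls. A tuple (u_1, ..., u_m) is
   a function on nat of which only the values on {1..m} matter. *)
type_synonym oracle_answers = "nat \<Rightarrow> (nat \<Rightarrow> real vec) \<Rightarrow> real vec option"

definition lp_oracle ::
  "real mat \<Rightarrow> nat \<Rightarrow> (nat \<Rightarrow> real vec) \<Rightarrow> (nat \<Rightarrow> real) \<Rightarrow> real \<Rightarrow> oracle_answers \<Rightarrow> bool" where
  "lp_oracle P m a b \<alpha> orc \<longleftrightarrow>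
     (\<forall>t. \<forall>u \<in> {1..m} \<rightarrow> unit_ball (dim_col P).
        case orc t u of
          Some x \<Rightarrow> x \<in> unit_ball (dim_row P) \<and> (\<forall>i\<in>{1..m}. constraint P a b i x (u i) \<le> \<alpha>)
        | None \<Rightarrow> \<not> (\<exists>x\<in>unit_ball (dim_row P). \<forall>i\<in>{1..m}. constraint P a b i x (u i) \<le> 0))"

definition subgradient_step ::
  "real mat \<Rightarrow> real \<Rightarrow> real vec \<Rightarrow> real vec \<Rightarrow> real vec" where
  "subgradient_step P \<eta> x u =
     (let w = u + \<eta> \<cdot>\<^sub>v (P\<^sup>T *\<^sub>v x) in (1 / max (euclidean_norm w) 1) \<cdot>\<^sub>v w)"

(* The number argument that is recursed on is the number of remaining rounds, t is the number of
   oracle calls made so far, u is the next query and s is the sum of the oracle's answers so far.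
   The second component of the result is the total number of calls. *)
primrec dual_subgradient_rounds ::
  "real mat \<Rightarrow> real \<Rightarrow> oracle_answers \<Rightarrow> nat \<Rightarrow> nat \<Rightarrow> (nat \<Rightarrow> real vec) \<Rightarrow> real vec
     \<Rightarrow> real vec option \<times> nat" where
  "dual_subgradient_rounds P \<eta> orc 0 t u s = (Some s, t)"
| "dual_subgradient_rounds P \<eta> orc (Suc k) t u s =
     (case orc (Suc t) u of
        None \<Rightarrow> (None, Suc t)
      | Some x \<Rightarrow>
          dual_subgradient_rounds P \<eta> orc k (Suc t) (\<lambda>i. subgradient_step P \<eta> x (u i)) (s + x))"

definition dual_subgradient_horizon :: "real \<Rightarrow> real \<Rightarrow> real \<Rightarrow> nat" where
  "dual_subgradient_horizon \<alpha> D G = nat \<lceil>G\<^sup>2 * D\<^sup>2 / \<alpha>\<^sup>2\<rceil>"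

definition dual_subgradient ::
  "real mat \<Rightarrow> real \<Rightarrow> real \<Rightarrow> real \<Rightarrow> oracle_answers \<Rightarrow> (nat \<Rightarrow> real vec) \<Rightarrow> real vec option \<times> nat" where
  "dual_subgradient P \<alpha> D G orc u1 =
     (let T = dual_subgradient_horizon \<alpha> D G;
          \<eta> = D / (G * sqrt (real T));
          (r, calls) = dual_subgradient_rounds P \<eta> orc T 0 u1 (0\<^sub>v (dim_row P))
      in (map_option (\<lambda>s. (1 / real T) \<cdot>\<^sub>v s) r, calls))"

end

theory Submission
  imports Defs
begin

text \<open>
  For a fixed \<open>x\<close> the constraint \<open>(a\<^sub>i + P u) \<bullet> x - b\<^sub>i\<close> is affine in \<open>u\<close> with gradient
  \<open>g = P\<^sup>T x\<close>, and \<open>\<parallel>g\<parallel> \<le> \<sigma>\<close> because the Frobenius norm bounds the operator norm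
  (\<open>transpose_mult_norm_le\<close>). So each \<open>u\<^sub>i\<close> plays projected online gradient ascent on the unit ball,
  against an opponent who answers with \<open>x\<^sup>t\<close>. Fix a competitor \<open>v\<close> in the ball. The
  projection brings a point no further from \<open>v\<close> (\<open>ball_projection_contracts\<close>), so a step satisfies
  \<open>2 \<eta> (g \<bullet> v - g \<bullet> u) \<le> \<parallel>u - v\<parallel>\<^sup>2 - \<parallel>u' - v\<parallel>\<^sup>2 + \<eta>\<^sup>2 \<sigma>\<^sup>2\<close> (\<open>subgradient_step_regret\<close>).
  Summed over all rounds the distances telescope, and since two points of the ball are at distance
  at most 2, the total regret is at most \<open>(4 + T \<eta>\<^sup>2 \<sigma>\<^sup>2) / (2 \<eta>)\<close>, which is \<open>2 \<sigma> \<surd>T\<close> for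
  \<open>\<eta> = 2 / (\<sigma> \<surd>T)\<close>. On average over the rounds this is \<open>2 \<sigma> / \<surd>T \<le> \<alpha>\<close> for the chosen horizon.

  The oracle keeps every constraint at \<open>u\<^sub>i\<^sup>t\<close> at most \<open>\<alpha>\<close>, so the average answer violates
  the constraint at \<open>v\<close> by at most \<open>\<alpha>\<close> plus the average regret, hence by at most \<open>2 \<alpha> = \<epsilon>\<close>
  (\<open>dual_subgradient_correct\<close>). A robust solution satisfies the constraints of every query, so an
  answer "infeasible" rules one out (\<open>rounds_infeasible\<close>). With \<open>D = 2\<close> and \<open>\<alpha> = \<epsilon> / 2\<close> the
  horizon is \<open>\<lceil>16 \<sigma>\<^sup>2 / \<epsilon>\<^sup>2\<rceil>\<close>, which gives \<open>C = 16\<close>.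
\<close>

section \<open>Euclidean and Frobenius norms\<close>

lemma euclidean_norm_nonneg: "0 \<le> euclidean_norm v"
  by (simp add: euclidean_norm_def L2_set_nonneg)

lemma scalar_prod_self: "v \<bullet> v = (euclidean_norm v)\<^sup>2"
  by (simp add: euclidean_norm_def L2_set_def sum_nonneg scalar_prod_def power2_eq_square
      atLeast0LessThan)

lemma euclidean_norm_smult: "euclidean_norm (c \<cdot>\<^sub>v v) = \<bar>c\<bar> * euclidean_norm v"
proof -
  have "(euclidean_norm (c \<cdot>\<^sub>v v))\<^sup>2 = (\<bar>c\<bar> * euclidean_norm v)\<^sup>2"
    by (simp add: scalar_prod_self[symmetric] power_mult_distrib)
       (simp add: power2_eq_square)
  then show ?thesis
    by (rule power2_eq_imp_eq) (simp_all add: euclidean_norm_nonneg)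
qed

lemma abs_scalar_prod_le_norms:
  assumes "v \<in> carrier_vec n" "w \<in> carrier_vec n"
  shows "\<bar>v \<bullet> w\<bar> \<le> euclidean_norm v * euclidean_norm w"
proof -
  have "\<bar>v \<bullet> w\<bar> = \<bar>\<Sum>j<n. v $ j * w $ j\<bar>"
    using assms by (simp add: scalar_prod_def atLeast0LessThan)
  also have "\<dots> \<le> (\<Sum>j<n. \<bar>v $ j\<bar> * \<bar>w $ j\<bar>)"
    using sum_abs[of "\<lambda>j. v $ j * w $ j" "{..<n}"] by (simp add: abs_mult)
  also have "\<dots> \<le> euclidean_norm v * euclidean_norm w"
    using L2_set_mult_ineq[of "\<lambda>j. v $ j" "\<lambda>j. w $ j" "{..<n}"] assms
    by (simp add: euclidean_norm_def)
  finally show ?thesis .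
qed

lemma euclidean_norm_add_le:
  assumes "v \<in> carrier_vec n" "w \<in> carrier_vec n"
  shows "euclidean_norm (v + w) \<le> euclidean_norm v + euclidean_norm w"
proof -
  have "euclidean_norm (v + w) = L2_set (\<lambda>j. v $ j + w $ j) {..<n}"
    using assms by (auto simp: euclidean_norm_def intro!: L2_set_cong)
  also have "\<dots> \<le> euclidean_norm v + euclidean_norm w"
    using L2_set_triangle_ineq[of "\<lambda>j. v $ j" "\<lambda>j. w $ j" "{..<n}"] assms
    by (simp add: euclidean_norm_def)
  finally show ?thesis .
qed

lemma square_norm_diff:
  fixes v w :: "real vec"
  assumes "v \<in> carrier_vec n" "w \<in> carrier_vec n"
  shows "(v - w) \<bullet> (v - w) = v \<bullet> v - 2 * (v \<bullet> w) + w \<bullet> w"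
proof -
  have "w \<bullet> v = v \<bullet> w"
    using assms by (rule comm_scalar_prod[rotated])
  then show ?thesis
    using assms by (simp add: minus_scalar_prod_distrib[of _ n] scalar_prod_minus_distrib[of _ n])
qed

text \<open>Each coordinate of \<open>P\<^sup>T x\<close> is the scalar product of a column of \<open>P\<close> with \<open>x\<close>, so the
  Cauchy-Schwarz inequality applies column by column, and the squared column norms add up to the
  squared Frobenius norm.\<close>

lemma transpose_mult_norm_le:
  assumes P: "P \<in> carrier_mat n K" and x: "x \<in> carrier_vec n"
  shows "euclidean_norm (P\<^sup>T *\<^sub>v x) \<le> frobenius_norm P * euclidean_norm x"
proof (rule power2_le_imp_le)
  have col: "((P\<^sup>T *\<^sub>v x) $ j)\<^sup>2 \<le> (\<Sum>i<n. (P $$ (i, j))\<^sup>2) * (euclidean_norm x)\<^sup>2"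
    if j: "j < K" for j
  proof -
    have c: "col P j \<in> carrier_vec n" using P by auto
    have "\<bar>col P j \<bullet> x\<bar> \<le> euclidean_norm (col P j) * euclidean_norm x"
      by (rule abs_scalar_prod_le_norms[OF c x])
    then have "(col P j \<bullet> x)\<^sup>2 \<le> (euclidean_norm (col P j) * euclidean_norm x)\<^sup>2"
      using power_mono[of "\<bar>col P j \<bullet> x\<bar>" _ 2] by simp
    moreover have "(euclidean_norm (col P j))\<^sup>2 = (\<Sum>i<n. (P $$ (i, j))\<^sup>2)"
      using P j by (auto simp: euclidean_norm_def L2_set_def sum_nonneg intro!: sum.cong)
    moreover have "(P\<^sup>T *\<^sub>v x) $ j = col P j \<bullet> x"
      using P j by simp
    ultimately show ?thesis by (simp add: power_mult_distrib)
  qed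
  have "(euclidean_norm (P\<^sup>T *\<^sub>v x))\<^sup>2 = (\<Sum>j<K. ((P\<^sup>T *\<^sub>v x) $ j)\<^sup>2)"
    using P by (simp add: euclidean_norm_def L2_set_def sum_nonneg)
  also have "\<dots> \<le> (\<Sum>j<K. (\<Sum>i<n. (P $$ (i, j))\<^sup>2) * (euclidean_norm x)\<^sup>2)"
    by (intro sum_mono col) simp
  also have "\<dots> = (\<Sum>i<n. \<Sum>j<K. (P $$ (i, j))\<^sup>2) * (euclidean_norm x)\<^sup>2"
    by (simp add: sum_distrib_right[symmetric] sum.swap[of _ "{..<n}"])
  also have "(\<Sum>i<n. \<Sum>j<K. (P $$ (i, j))\<^sup>2) = (frobenius_norm P)\<^sup>2"
    using P by (simp add: frobenius_norm_def L2_set_def sum_nonneg sum.cartesian_product case_prod_unfold)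
  finally show "(euclidean_norm (P\<^sup>T *\<^sub>v x))\<^sup>2 \<le> (frobenius_norm P * euclidean_norm x)\<^sup>2"
    by (simp add: power_mult_distrib)
  show "0 \<le> frobenius_norm P * euclidean_norm x"
    by (simp add: frobenius_norm_def L2_set_nonneg euclidean_norm_nonneg)
qed

lemma frobenius_norm_pos:
  assumes P: "P \<in> carrier_mat n K" and nz: "P \<noteq> 0\<^sub>m n K"
  shows "0 < frobenius_norm P"
proof -
  obtain i j where ij: "i < n" "j < K" "P $$ (i, j) \<noteq> 0"
    using P nz by (metis carrier_matD eq_matI index_zero_mat)
  have "frobenius_norm P \<noteq> 0"
    using P ij by (force simp: frobenius_norm_def L2_set_eq_0_iff)
  then show ?thesis
    by (simp add: frobenius_norm_def L2_set_nonneg less_le)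
qed

section \<open>One projected gradient step\<close>

text \<open>If \<open>r = \<parallel>w\<parallel> > 1\<close>, then expanding both squares reduces the second claim to
  \<open>2 (w \<bullet> v) (1 - 1/r) \<le> r\<^sup>2 - 1\<close>. The left-hand side is at most \<open>2 (r - 1)\<close> because
  \<open>w \<bullet> v \<le> r\<close>, and \<open>2 (r - 1) \<le> (r + 1) (r - 1)\<close>.\<close>

lemma ball_projection_contracts:
  assumes w: "w \<in> carrier_vec K" and v: "v \<in> unit_ball K"
  defines "q \<equiv> (1 / max (euclidean_norm w) 1) \<cdot>\<^sub>v w"
  shows "q \<in> unit_ball K" and "(q - v) \<bullet> (q - v) \<le> (w - v) \<bullet> (w - v)"
proof -
  define r where "r = max (euclidean_norm w) 1"
  have r: "r \<ge> 1" "euclidean_norm w \<le> r" by (simp_all add: r_def)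
  have vK: "v \<in> carrier_vec K" and v1: "euclidean_norm v \<le> 1"
    using v by (auto simp: unit_ball_def)
  have q: "q = (1 / r) \<cdot>\<^sub>v w" by (simp add: q_def r_def)
  have qK: "q \<in> carrier_vec K" using w by (simp add: q)
  show "q \<in> unit_ball K"
    using qK r by (simp add: unit_ball_def q euclidean_norm_smult)
  show "(q - v) \<bullet> (q - v) \<le> (w - v) \<bullet> (w - v)"
  proof (cases "euclidean_norm w \<le> 1")
    case True
    then show ?thesis by (simp add: q r_def)
  next
    case False
    then have rw: "r = euclidean_norm w" and r1: "r > 1" by (simp_all add: r_def)
    have ww: "w \<bullet> w = r\<^sup>2" by (simp add: scalar_prod_self rw)
    have "w \<bullet> v \<le> r * euclidean_norm v"
      using abs_scalar_prod_le_norms[OF w vK] by (simp add: rw)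
    also have "\<dots> \<le> r" using v1 r1 by simp
    finally have "w \<bullet> v * (1 - 1 / r) \<le> r * (1 - 1 / r)"
      using r1 by (intro mult_right_mono) auto
    also have "\<dots> = r - 1" using r1 by (simp add: field_simps)
    finally have "2 * (w \<bullet> v) - 2 * ((w \<bullet> v) / r) \<le> r\<^sup>2 - 1"
      using zero_le_power2[of "r - 1"]
      by (simp add: right_diff_distrib power2_diff)
    moreover have "q \<bullet> q = 1" "q \<bullet> v = (w \<bullet> v) / r"
      using w vK ww r1 by (simp_all add: q power2_eq_square)
    ultimately show ?thesis
      using square_norm_diff[OF qK vK] square_norm_diff[OF w vK] ww by simp
  qed
qed

lemma subgradient_step_in_ball:
  assumes "P \<in> carrier_mat n K" "u \<in> carrier_vec K"
  shows "subgradient_step P \<eta> x u \<in> unit_ball K"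
proof -
  have "0\<^sub>v K \<in> unit_ball K"
    by (simp add: unit_ball_def euclidean_norm_def L2_set_def)
  then show ?thesis
    unfolding subgradient_step_def Let_def
    using assms by (intro ball_projection_contracts(1) add_carrier_vec) (auto intro: carrier_vecI)
qed

text \<open>The gain of a fixed competitor \<open>v\<close> over the current \<open>u\<close> is paid for by the decrease of the
  squared distance to \<open>v\<close>, up to the squared length of the step. The difference of squared
  distances is what telescopes over the rounds.\<close>

lemma subgradient_step_regret:
  assumes P: "P \<in> carrier_mat n K" and x: "x \<in> unit_ball n"
    and u: "u \<in> unit_ball K" and v: "v \<in> unit_ball K" and \<eta>: "\<eta> > 0"
  defines "u' \<equiv> subgradient_step P \<eta> x u"
  shows "(P *\<^sub>v v) \<bullet> x - (P *\<^sub>v u) \<bullet> x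
    \<le> ((u - v) \<bullet> (u - v) - (u' - v) \<bullet> (u' - v) + \<eta>\<^sup>2 * (frobenius_norm P)\<^sup>2) / (2 * \<eta>)"
proof -
  define g where "g = P\<^sup>T *\<^sub>v x"
  have xK: "x \<in> carrier_vec n" and x1: "euclidean_norm x \<le> 1"
    and uK: "u \<in> carrier_vec K" and vK: "v \<in> carrier_vec K"
    using x u v by (auto simp: unit_ball_def)
  have gK: "g \<in> carrier_vec K" using P by (auto simp: g_def intro: carrier_vecI)
  have adj: "(P *\<^sub>v y) \<bullet> x = g \<bullet> y" if "y \<in> carrier_vec K" for y
  proof -
    have "P *\<^sub>v y \<in> carrier_vec n" using P by (auto intro: carrier_vecI)
    then show ?thesis
      using transpose_vec_mult_scalar[OF P that xK] comm_scalar_prod[of "P *\<^sub>v y" n x] xK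
      by (simp add: g_def)
  qed
  have "frobenius_norm P * euclidean_norm x \<le> frobenius_norm P * 1"
    using x1 by (intro mult_left_mono) (simp_all add: frobenius_norm_def L2_set_nonneg)
  then have "euclidean_norm g \<le> frobenius_norm P"
    using transpose_mult_norm_le[OF P xK] by (simp add: g_def)
  then have gg: "g \<bullet> g \<le> (frobenius_norm P)\<^sup>2"
    by (simp add: scalar_prod_self power_mono euclidean_norm_nonneg)
  define w where "w = u + \<eta> \<cdot>\<^sub>v g"
  have wK: "w \<in> carrier_vec K" using uK gK by (simp add: w_def)
  have "(u' - v) \<bullet> (u' - v) \<le> (w - v) \<bullet> (w - v)"
    using ball_projection_contracts(2)[OF wK v]
    by (simp add: u'_def subgradient_step_def Let_def w_def g_def)
  also have "\<dots> = (u - v) \<bullet> (u - v) + 2 * \<eta> * (g \<bullet> u - g \<bullet> v) + \<eta>\<^sup>2 * (g \<bullet> g)"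
  proof -
    have "w \<bullet> w = u \<bullet> u + 2 * \<eta> * (g \<bullet> u) + \<eta>\<^sup>2 * (g \<bullet> g)"
      using uK gK comm_scalar_prod[OF uK gK]
      by (simp add: w_def add_scalar_prod_distrib[of _ K] scalar_prod_add_distrib[of _ K]
          algebra_simps power2_eq_square)
    moreover have "w \<bullet> v = u \<bullet> v + \<eta> * (g \<bullet> v)"
      using uK gK vK by (simp add: w_def add_scalar_prod_distrib[of _ K])
    ultimately show ?thesis
      using square_norm_diff[OF wK vK] square_norm_diff[OF uK vK] by (simp add: algebra_simps)
  qed
  also have "\<dots> \<le> (u - v) \<bullet> (u - v) + 2 * \<eta> * (g \<bullet> u - g \<bullet> v) + \<eta>\<^sup>2 * (frobenius_norm P)\<^sup>2"
    using gg by (intro add_left_mono mult_left_mono) auto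
  finally show ?thesis
    using \<eta> by (simp add: adj uK vK field_simps)
qed

section \<open>The rounds of the algorithm\<close>

text \<open>Every query consists of points of the uncertainty set, since the projected steps stay in
  it. Hence a robust solution would be feasible for the very query that was declared infeasible.\<close>

lemma rounds_infeasible:
  assumes P: "P \<in> carrier_mat n K" and orc: "lp_oracle P m a b \<alpha> orc"
    and u: "u \<in> {1..m} \<rightarrow> unit_ball K"
    and run: "dual_subgradient_rounds P \<eta> orc k t u s = (None, c)"
  shows "\<not> (\<exists>x. robust_solution P m a b x)"
  using u run
proof (induction k arbitrary: t u s)
  case 0
  then show ?case by simp
next
  case (Suc k)
  show ?case
  proof (cases "orc (Suc t) u")
    case None
    then have "\<not> (\<exists>x\<in>unit_ball (dim_row P). \<forall>i\<in>{1..m}. constraint P a b i x (u i) \<le> 0)"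
      using orc[unfolded lp_oracle_def, rule_format, of u "Suc t"] Suc.prems(1) P by simp
    then show ?thesis
      using Suc.prems(1) P by (fastforce simp: robust_solution_def)
  next
    case (Some x)
    have "(\<lambda>i. subgradient_step P \<eta> x (u i)) \<in> {1..m} \<rightarrow> unit_ball K"
      using Suc.prems(1) subgradient_step_in_ball[OF P] by (auto simp: unit_ball_def)
    then show ?thesis
      using Suc.IH Suc.prems(2) Some by simp
  qed
qed

lemma rounds_calls_le: "snd (dual_subgradient_rounds P \<eta> orc k t u s) \<le> t + k"
proof (induction k arbitrary: t u s)
  case (Suc k)
  show ?case
    using Suc.IH[of "Suc t"] by (auto split: option.split)
qed simp

text \<open>The regret bound is stated for a run that starts at an arbitrary query \<open>u\<close> and partial sum
  \<open>s\<close>, so that the induction on the remaining rounds goes through: the summand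
  \<open>(u i - v) \<bullet> (u i - v)\<close> is the potential that the next step spends. The norm bound on \<open>s'\<close>
  is what places the average of the answers in the unit ball.\<close>

lemma rounds_regret:
  assumes P: "P \<in> carrier_mat n K" and orc: "lp_oracle P m a b \<alpha> orc"
    and a: "\<forall>i\<in>{1..m}. a i \<in> carrier_vec n" and \<eta>: "\<eta> > 0"
    and u: "u \<in> {1..m} \<rightarrow> unit_ball K" and s: "s \<in> carrier_vec n"
    and run: "dual_subgradient_rounds P \<eta> orc k t u s = (Some s', c)"
  shows "s' \<in> carrier_vec n \<and> euclidean_norm s' \<le> euclidean_norm s + real k \<and>
    (\<forall>i\<in>{1..m}. \<forall>v\<in>unit_ball K. (a i + P *\<^sub>v v) \<bullet> s'
       \<le> (a i + P *\<^sub>v v) \<bullet> s + real k * (b i + \<alpha>)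
         + ((u i - v) \<bullet> (u i - v) + real k * \<eta>\<^sup>2 * (frobenius_norm P)\<^sup>2) / (2 * \<eta>))"
  using u s run
proof (induction k arbitrary: t u s)
  case 0
  then show ?case
    using \<eta> by (auto simp: scalar_prod_self)
next
  case (Suc k)
  from Suc.prems(3) obtain x where x: "orc (Suc t) u = Some x"
    and run: "dual_subgradient_rounds P \<eta> orc k (Suc t)
      (\<lambda>i. subgradient_step P \<eta> x (u i)) (s + x) = (Some s', c)"
    by (auto split: option.splits)
  have xn: "x \<in> unit_ball n" and xc: "\<And>i. i \<in> {1..m} \<Longrightarrow> constraint P a b i x (u i) \<le> \<alpha>"
    using orc Suc.prems(1) P x by (fastforce simp: lp_oracle_def split: option.splits)+
  have xK: "x \<in> carrier_vec n" and x1: "euclidean_norm x \<le> 1"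
    using xn by (auto simp: unit_ball_def)
  let ?u' = "\<lambda>i. subgradient_step P \<eta> x (u i)"
  have u': "?u' \<in> {1..m} \<rightarrow> unit_ball K"
    using Suc.prems(1) subgradient_step_in_ball[OF P] by (auto simp: unit_ball_def)
  have sx: "s + x \<in> carrier_vec n" using Suc.prems(2) xK by simp
  note IH = Suc.IH[OF u' sx run]
  have "(a i + P *\<^sub>v v) \<bullet> s'
       \<le> (a i + P *\<^sub>v v) \<bullet> s + real (Suc k) * (b i + \<alpha>)
         + ((u i - v) \<bullet> (u i - v) + real (Suc k) * \<eta>\<^sup>2 * (frobenius_norm P)\<^sup>2) / (2 * \<eta>)"
    if i: "i \<in> {1..m}" and v: "v \<in> unit_ball K" for i v
  proof -
    let ?d = "\<lambda>u. (u - v) \<bullet> (u - v)"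
    have ui: "u i \<in> unit_ball K" using Suc.prems(1) i by auto
    have ai: "a i \<in> carrier_vec n" using a i by blast
    have [simp]: "P *\<^sub>v v \<in> carrier_vec n" "P *\<^sub>v u i \<in> carrier_vec n"
      using P by (auto intro: carrier_vecI)
    have "(a i + P *\<^sub>v v) \<bullet> s' \<le> (a i + P *\<^sub>v v) \<bullet> (s + x) + real k * (b i + \<alpha>)
         + (?d (?u' i) + real k * \<eta>\<^sup>2 * (frobenius_norm P)\<^sup>2) / (2 * \<eta>)"
      using IH i v by blast
    moreover have "(a i + P *\<^sub>v v) \<bullet> (s + x) = (a i + P *\<^sub>v v) \<bullet> s + (a i + P *\<^sub>v v) \<bullet> x"
      using ai Suc.prems(2) xK by (intro scalar_prod_add_distrib[of _ n]) auto
    moreover have "(a i + P *\<^sub>v v) \<bullet> x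
        = (a i + P *\<^sub>v u i) \<bullet> x + ((P *\<^sub>v v) \<bullet> x - (P *\<^sub>v u i) \<bullet> x)"
      using ai xK by (simp add: add_scalar_prod_distrib[of _ n])
    moreover have "(a i + P *\<^sub>v u i) \<bullet> x \<le> b i + \<alpha>"
      using xc[OF i] by (simp add: constraint_def)
    moreover note subgradient_step_regret[OF P xn ui v \<eta>]
    ultimately show ?thesis
      by (simp add: add_divide_distrib diff_divide_distrib algebra_simps)
  qed
  moreover have "euclidean_norm s' \<le> euclidean_norm s + real (Suc k)"
    using IH euclidean_norm_add_le[OF Suc.prems(2) xK] x1 by simp
  ultimately show ?case using IH by blast
qed

section \<open>Correctness of the returned average\<close>

text \<open>The step size \<open>2 / (\<sigma> \<surd>T)\<close> balances the two parts of the regret bound: the initial squared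
  distance is at most 4, and the step lengths contribute \<open>T \<eta>\<^sup>2 \<sigma>\<^sup>2 = 4\<close>. The horizon satisfies
  \<open>2 \<sigma> / \<alpha> \<le> \<surd>T\<close>, which turns the total regret \<open>2 \<sigma> \<surd>T\<close> into at most \<open>\<alpha> T\<close>; the oracle's
  tolerance contributes the other \<open>\<alpha> T\<close>.\<close>

lemma dual_subgradient_correct:
  assumes P: "P \<in> carrier_mat n K" and nz: "P \<noteq> 0\<^sub>m n K"
    and a: "\<forall>i\<in>{1..m}. a i \<in> carrier_vec n" and \<alpha>: "\<alpha> > 0"
    and orc: "lp_oracle P m a b \<alpha> orc" and u: "u \<in> {1..m} \<rightarrow> unit_ball K"
    and res: "dual_subgradient P \<alpha> 2 (frobenius_norm P) orc u = (Some x, c)"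
  shows "approx_robust_solution P m a b (2 * \<alpha>) x"
proof -
  define \<sigma> where "\<sigma> = frobenius_norm P"
  define T where "T = dual_subgradient_horizon \<alpha> 2 \<sigma>"
  define \<eta> where "\<eta> = 2 / (\<sigma> * sqrt (real T))"
  have \<sigma>: "\<sigma> > 0" using frobenius_norm_pos[OF P nz] by (simp add: \<sigma>_def)
  \<comment> \<open>The horizon is positive because \<open>P\<close> is nonzero; so the average is over at least one answer.\<close>
  have "(2 * \<sigma> / \<alpha>)\<^sup>2 = \<sigma>\<^sup>2 * 2\<^sup>2 / \<alpha>\<^sup>2"
    by (simp add: power_mult_distrib power_divide)
  also have "\<dots> \<le> real T"
    unfolding T_def dual_subgradient_horizon_def by (rule real_nat_ceiling_ge)
  finally have T: "(2 * \<sigma> / \<alpha>)\<^sup>2 \<le> real T" .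
  moreover have "(2 * \<sigma> / \<alpha>)\<^sup>2 > 0" using \<sigma> \<alpha> by simp
  ultimately have T0: "real T > 0" by linarith
  have sT: "2 * \<sigma> / \<alpha> \<le> sqrt (real T)" using T by (rule real_le_rsqrt)
  have \<eta>: "\<eta> > 0" using \<sigma> T0 by (simp add: \<eta>_def)
  obtain s where run: "dual_subgradient_rounds P \<eta> orc T 0 u (0\<^sub>v n) = (Some s, c)"
    and x: "x = (1 / real T) \<cdot>\<^sub>v s"
    using res P by (auto simp: dual_subgradient_def Let_def T_def[symmetric] \<sigma>_def[symmetric]
        \<eta>_def[symmetric] split: prod.splits)
  have z: "0\<^sub>v n \<in> carrier_vec n" "euclidean_norm (0\<^sub>v n) = 0"
    by (simp_all add: euclidean_norm_def L2_set_def)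
  have s: "s \<in> carrier_vec n" "euclidean_norm s \<le> real T"
    and reg: "\<And>i v. i \<in> {1..m} \<Longrightarrow> v \<in> unit_ball K \<Longrightarrow> (a i + P *\<^sub>v v) \<bullet> s
       \<le> (a i + P *\<^sub>v v) \<bullet> 0\<^sub>v n + real T * (b i + \<alpha>)
         + ((u i - v) \<bullet> (u i - v) + real T * \<eta>\<^sup>2 * \<sigma>\<^sup>2) / (2 * \<eta>)"
    using rounds_regret[OF P orc a \<eta> u z(1) run] z(2) by (auto simp: \<sigma>_def)
  have "constraint P a b i x v \<le> 2 * \<alpha>" if i: "i \<in> {1..m}" and v: "v \<in> unit_ball K" for i v
  proof -
    have c: "a i + P *\<^sub>v v \<in> carrier_vec n"
      using a i P by (intro add_carrier_vec) (auto intro: carrier_vecI)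
    have ui: "u i \<in> unit_ball K" using u i by auto
    have "u i - v = u i + (-1) \<cdot>\<^sub>v v"
      using ui v by (intro eq_vecI) (auto simp: unit_ball_def)
    then have "euclidean_norm (u i - v) \<le> euclidean_norm (u i) + euclidean_norm v"
      using euclidean_norm_add_le[of "u i" K "(-1) \<cdot>\<^sub>v v"] ui v
      by (simp add: unit_ball_def euclidean_norm_smult)
    also have "\<dots> \<le> 2" using ui v by (simp add: unit_ball_def)
    finally have d: "(u i - v) \<bullet> (u i - v) \<le> 4"
      using power_mono[of "euclidean_norm (u i - v)" 2 2]
      by (simp add: scalar_prod_self euclidean_norm_nonneg)
    have e: "real T * \<eta>\<^sup>2 * \<sigma>\<^sup>2 = 4"
      using \<sigma> T0 by (simp add: \<eta>_def power_divide power_mult_distrib)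
    have "((u i - v) \<bullet> (u i - v) + real T * \<eta>\<^sup>2 * \<sigma>\<^sup>2) / (2 * \<eta>) \<le> 8 / (2 * \<eta>)"
      using d e \<eta> by (intro divide_right_mono) auto
    also have "\<dots> = 2 * \<sigma> * sqrt (real T)" using \<sigma> T0 by (simp add: \<eta>_def)
    also have "\<dots> \<le> \<alpha> * sqrt (real T) * sqrt (real T)"
      using sT \<alpha> by (intro mult_right_mono) (auto simp: field_simps)
    also have "\<dots> = \<alpha> * real T" by simp
    finally have "(a i + P *\<^sub>v v) \<bullet> s \<le> real T * (b i + 2 * \<alpha>)"
      using reg[OF i v] c by (simp add: algebra_simps)
    moreover have "(a i + P *\<^sub>v v) \<bullet> x = ((a i + P *\<^sub>v v) \<bullet> s) / real T"
      using c s by (simp add: x)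
    ultimately have "(a i + P *\<^sub>v v) \<bullet> x \<le> b i + 2 * \<alpha>"
      using T0 by (simp add: pos_divide_le_eq mult.commute)
    then show ?thesis
      by (simp add: constraint_def)
  qed
  moreover have "x \<in> unit_ball n"
    using s T0 by (simp add: x unit_ball_def euclidean_norm_smult)
  ultimately show ?thesis
    using P by (auto simp: approx_robust_solution_def)
qed

theorem corollary10:
  shows "\<exists>C::real. \<forall>(n::nat) (K::nat) (m::nat) (P::real mat) (a::nat \<Rightarrow> real vec) (b::nat \<Rightarrow> real)
           (\<epsilon>::real) (orc::oracle_answers) (u1::nat \<Rightarrow> real vec).
       P \<in> carrier_mat n K \<longrightarrow> P \<noteq> 0\<^sub>m n K \<longrightarrow>
       (\<forall>i\<in>{1..m}. a i \<in> carrier_vec n) \<longrightarrow>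
       \<epsilon> > 0 \<longrightarrow>
       lp_oracle P m a b (\<epsilon> / 2) orc \<longrightarrow>
       u1 \<in> {1..m} \<rightarrow> unit_ball K \<longrightarrow>
       (let \<sigma> = frobenius_norm P;
            T = dual_subgradient_horizon (\<epsilon> / 2) 2 \<sigma>;
            (result, calls) = dual_subgradient P (\<epsilon> / 2) 2 \<sigma> orc u1
        in (case result of
              Some x \<Rightarrow> approx_robust_solution P m a b \<epsilon> x
            | None \<Rightarrow> \<not> (\<exists>x. robust_solution P m a b x)) \<and>
           calls \<le> T \<and> real T \<le> 1 + C * \<sigma>\<^sup>2 / \<epsilon>\<^sup>2)"
proof (intro exI[of _ 16] allI impI)
  fix n K m :: nat and P :: "real mat" and a :: "nat \<Rightarrow> real vec" and b :: "nat \<Rightarrow> real"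
    and \<epsilon> :: real and orc :: oracle_answers and u1 :: "nat \<Rightarrow> real vec"
  assume P: "P \<in> carrier_mat n K" and nz: "P \<noteq> 0\<^sub>m n K"
    and a: "\<forall>i\<in>{1..m}. a i \<in> carrier_vec n" and \<epsilon>: "\<epsilon> > 0"
    and orc: "lp_oracle P m a b (\<epsilon> / 2) orc" and u1: "u1 \<in> {1..m} \<rightarrow> unit_ball K"
  define \<sigma> where "\<sigma> = frobenius_norm P"
  define T where "T = dual_subgradient_horizon (\<epsilon> / 2) 2 \<sigma>"
  obtain r c where rc: "dual_subgradient P (\<epsilon> / 2) 2 \<sigma> orc u1 = (r, c)"
    by (cases "dual_subgradient P (\<epsilon> / 2) 2 \<sigma> orc u1")
  obtain r' where run: "dual_subgradient_rounds P (2 / (\<sigma> * sqrt (real T))) orc T 0 u1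
      (0\<^sub>v (dim_row P)) = (r', c)"
    and r: "r = map_option (\<lambda>s. (1 / real T) \<cdot>\<^sub>v s) r'"
    using rc by (auto simp: dual_subgradient_def Let_def T_def[symmetric] split: prod.splits)
  have "case r of Some x \<Rightarrow> approx_robust_solution P m a b \<epsilon> x
    | None \<Rightarrow> \<not> (\<exists>x. robust_solution P m a b x)"
  proof (cases r)
    case None
    then show ?thesis
      using rounds_infeasible[OF P orc u1] run r by auto
  next
    case (Some x)
    then show ?thesis
      using dual_subgradient_correct[OF P nz a _ orc u1] rc \<epsilon> by (auto simp: \<sigma>_def)
  qed
  moreover have "c \<le> T"
    using rounds_calls_le[of P _ orc T 0] run by (metis add_0 snd_conv)
  moreover have "real T \<le> 1 + 16 * \<sigma>\<^sup>2 / \<epsilon>\<^sup>2"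
  proof -
    have "real T \<le> \<sigma>\<^sup>2 * 2\<^sup>2 / (\<epsilon> / 2)\<^sup>2 + 1"
      using ceiling_correct[of "\<sigma>\<^sup>2 * 2\<^sup>2 / (\<epsilon> / 2)\<^sup>2"]
      by (simp add: T_def dual_subgradient_horizon_def)
    then show ?thesis by (simp add: power_divide mult.commute)
  qed
  ultimately show "let \<sigma> = frobenius_norm P;
            T = dual_subgradient_horizon (\<epsilon> / 2) 2 \<sigma>;
            (result, calls) = dual_subgradient P (\<epsilon> / 2) 2 \<sigma> orc u1
        in (case result of
              Some x \<Rightarrow> approx_robust_solution P m a b \<epsilon> x
            | None \<Rightarrow> \<not> (\<exists>x. robust_solution P m a b x)) \<and>
           calls \<le> T \<and> real T \<le> 1 + 16 * \<sigma>\<^sup>2 / \<epsilon>\<^sup>2"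
    unfolding Let_def \<sigma>_def[symmetric] T_def[symmetric] rc by simp
qed

end
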